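(* Let $C$ be a clique cutset in a graph $G$, let $(A,B,C)$ be a cut-partition of $G$, and let $G_A=G[A\cup C]$ and $G_B=G[B\cup C]$. Then $\mathsf{tree}\text{-}\alpha(G)=\max\{\mathsf{tree}\text{-}\alpha(G_A),\mathsf{tree}\text{-}\alpha(G_B)\}$.
   Context: All graphs are finite, simple, and undirected. A cut-partition in a graph $G$ is a triple $(A,B,C)$ of pairwise disjoint sets such that $A\cup B\cup C=V(G)$, $A\neq\emptyset$, $B\neq\emptyset$, and $G$ has no edges with one endpoint in $A$ and one in $B$. A clique cutset in $G$ is a clique $C$ (set of pairwise adjacent vertices) such that $G$ has a cut-partition $(A,B,C)$ for some $A$ and $B$. A tree decomposition of a graph $G$ is a pair $\mathcal{T}=(T,\{X_t\}_{t\in V(T)})$ where $T$ is a tree and each node $t$ is assigned a bag $X_t\subseteq V(G)$ such that every vertex of $G$ is in at least one bag, every edge of $G$ has both endpoints in some common bag, and for every $u\in V(G)$ the subgraph of $T$ induced by $\{t: u\in X_t\}$ is connected. The independence number of $\mathcal{T}$ is $\alpha(\mathcal{T})=\max_{t\in V(T)}\alpha(G[X_t])$, where $\alpha(H)$ is the maximum size of an independent set in $H$. The tree-independence number $\mathsf{tree}\text{-}\alpha(G)$ is the minimum of $\alpha(\mathcal{T})$ over all tree decompositions $\mathcal{T}$ of $G$. *)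

theory Defs
  imports "Graph_Theory.Graph_Theory"
begin

text \<open>
  Finite simple undirected graphs are symmetric loop-free digraphs without multiple arcs,
  i.e. instances of the locale \<open>graph\<close>; each edge is a pair of opposite arcs, and
  \<open>G \<restriction> S\<close> is the subgraph of \<open>G\<close> induced by \<open>S\<close>.
\<close>

definition clique :: "('a, 'b) pre_digraph \<Rightarrow> 'a set \<Rightarrow> bool" where
  "clique G C \<longleftrightarrow> C \<subseteq> verts G \<and> pairwise (\<lambda>u v. u \<rightarrow>\<^bsub>G\<^esub> v) C"

definition cut_partition ::
  "('a, 'b) pre_digraph \<Rightarrow> 'a set \<Rightarrow> 'a set \<Rightarrow> 'a set \<Rightarrow> bool" where
  "cut_partition G A B C \<longleftrightarrow>
     A \<inter> B = {} \<and> A \<inter> C = {} \<and> B \<inter> C = {} \<and> A \<union> B \<union> C = verts G \<and>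
     A \<noteq> {} \<and> B \<noteq> {} \<and> (\<forall>a\<in>A. \<forall>b\<in>B. \<not> a \<rightarrow>\<^bsub>G\<^esub> b \<and> \<not> b \<rightarrow>\<^bsub>G\<^esub> a)"

definition clique_cutset :: "('a, 'b) pre_digraph \<Rightarrow> 'a set \<Rightarrow> bool" where
  "clique_cutset G C \<longleftrightarrow> clique G C \<and> (\<exists>A B. cut_partition G A B C)"

definition indep_set :: "('a, 'b) pre_digraph \<Rightarrow> 'a set \<Rightarrow> bool" where
  "indep_set G S \<longleftrightarrow> S \<subseteq> verts G \<and> (\<forall>u\<in>S. \<forall>v\<in>S. \<not> u \<rightarrow>\<^bsub>G\<^esub> v)"

definition indep_number :: "('a, 'b) pre_digraph \<Rightarrow> nat" where
  "indep_number G = Max {card S | S. indep_set G S}"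

text \<open>
  The library's \<open>tree\<close> is not usable for symmetric digraphs, since an arc followed by its
  reverse is a \<open>cycle\<close> of length 2. The cycles of the underlying undirected graph are the
  cycles of length at least 3. A tree is nonempty, as \<open>connected\<close> includes nonemptiness.
\<close>

definition undirected_tree :: "('t, 'e) pre_digraph \<Rightarrow> bool" where
  "undirected_tree T \<longleftrightarrow>
     graph T \<and> connected T \<and> \<not> (\<exists>p. pre_digraph.cycle T p \<and> length p \<ge> 3)"

definition tree_decomposition ::
  "('a, 'b) pre_digraph \<Rightarrow> ('t, 'e) pre_digraph \<Rightarrow> ('t \<Rightarrow> 'a set) \<Rightarrow> bool" where
  "tree_decomposition G T X \<longleftrightarrow>
     undirected_tree T \<and>
     (\<forall>t\<in>verts T. X t \<subseteq> verts G) \<and>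
     (\<forall>u\<in>verts G. \<exists>t\<in>verts T. u \<in> X t) \<and>
     (\<forall>u v. u \<rightarrow>\<^bsub>G\<^esub> v \<longrightarrow> (\<exists>t\<in>verts T. u \<in> X t \<and> v \<in> X t)) \<and>
     (\<forall>u\<in>verts G. connected (T \<restriction> {t \<in> verts T. u \<in> X t}))"

definition decomp_indep_number ::
  "('a, 'b) pre_digraph \<Rightarrow> ('t, 'e) pre_digraph \<Rightarrow> ('t \<Rightarrow> 'a set) \<Rightarrow> nat" where
  "decomp_indep_number G T X = Max {indep_number (G \<restriction> X t) | t. t \<in> verts T}"

text \<open>
  Decomposition trees are finite, so it is no restriction to take natural numbers as nodes
  and pairs of nodes as arcs.
\<close>

definition tree_alpha :: "('a, 'b) pre_digraph \<Rightarrow> nat" where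
  "tree_alpha G =
     (LEAST k. \<exists>(T :: nat pair_pre_digraph) X.
        tree_decomposition G (with_proj T) X \<and> decomp_indep_number G (with_proj T) X = k)"

end

theory Submission
  imports Defs
begin

text \<open>
  Intersecting the bags of a tree decomposition with \<open>S\<close> decomposes the subgraph induced by
  \<open>S\<close>, hence \<open>tree_alpha\<close> does not increase under taking induced subgraphs. Conversely, the
  nodes whose bag contains a given vertex form a subtree, and the subtrees of the vertices of the
  clique \<open>C\<close> intersect pairwise; by the Helly property of subtrees some bag of each of the two
  given decompositions contains \<open>C\<close>. Joining two such bags by an edge yields a tree
  decomposition of \<open>G\<close> that has no new bags.

  Finite trees are exactly the graphs that arise from a single node by successively attaching
  leaves: a spanning tree of an acyclic graph built in this way has all edges, as any further edge
  would close a cycle, and conversely a cycle cannot pass through the leaf attached last. Both the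
  Helly property and the joining of trees are proved by induction on this construction.
\<close>

section \<open>Connected sets of nodes\<close>

definition connected_on :: "'t rel \<Rightarrow> 't set \<Rightarrow> bool" where
  "connected_on E S \<longleftrightarrow> S \<noteq> {} \<and> (\<forall>u\<in>S. \<forall>v\<in>S. (u, v) \<in> (Restr E S)\<^sup>*)"

lemma connected_on_singleton: "connected_on E {v}"
  by (simp add: connected_on_def)

lemma connected_on_mono:
  assumes "connected_on E S" "E \<subseteq> E'"
  shows "connected_on E' S"
  using assms rtrancl_mono[of "Restr E S" "Restr E' S"] by (auto simp: connected_on_def)

lemma connected_on_image:
  assumes "connected_on E S"
  shows "connected_on (map_prod f f ` E) (f ` S)"
proof -
  have "(f u, f v) \<in> (Restr (map_prod f f ` E) (f ` S))\<^sup>*" if "(u, v) \<in> (Restr E S)\<^sup>*" for u v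
    using that
  proof (induction rule: rtrancl_induct)
    case (step y z)
    then have "(f y, f z) \<in> Restr (map_prod f f ` E) (f ` S)" by auto
    with step.IH show ?case by (rule rtrancl_into_rtrancl)
  qed simp
  then show ?thesis using assms by (simp add: connected_on_def)
qed

lemma connected_on_join:
  assumes S\<^sub>1: "connected_on E S\<^sub>1" and S\<^sub>2: "connected_on E S\<^sub>2"
    and ab: "a \<in> S\<^sub>1" "b \<in> S\<^sub>2" "(a, b) \<in> E" "(b, a) \<in> E"
  shows "connected_on E (S\<^sub>1 \<union> S\<^sub>2)"
proof -
  let ?R = "(Restr E (S\<^sub>1 \<union> S\<^sub>2))\<^sup>*"
  have "(Restr E S\<^sub>1)\<^sup>* \<subseteq> ?R" "(Restr E S\<^sub>2)\<^sup>* \<subseteq> ?R" by (intro rtrancl_mono; auto)+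
  then have "\<forall>u\<in>S\<^sub>1. (u, a) \<in> ?R \<and> (a, u) \<in> ?R" "\<forall>u\<in>S\<^sub>2. (u, b) \<in> ?R \<and> (b, u) \<in> ?R"
    using S\<^sub>1 S\<^sub>2 ab by (auto simp: connected_on_def)
  moreover have "(a, b) \<in> ?R" "(b, a) \<in> ?R" using ab by auto
  ultimately have "(u, a) \<in> ?R \<and> (a, u) \<in> ?R" if "u \<in> S\<^sub>1 \<union> S\<^sub>2" for u
    using that by (meson Un_iff rtrancl_trans)
  then have "(u, v) \<in> ?R" if "u \<in> S\<^sub>1 \<union> S\<^sub>2" "v \<in> S\<^sub>1 \<union> S\<^sub>2" for u v
    using rtrancl_trans[of u a _ v] that by blast
  then show ?thesis using ab(1) unfolding connected_on_def by blast
qed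

lemma connected_on_Un_edge:
  assumes S\<^sub>1: "S\<^sub>1 \<noteq> {} \<Longrightarrow> connected_on E\<^sub>1 S\<^sub>1" and S\<^sub>2: "S\<^sub>2 \<noteq> {} \<Longrightarrow> connected_on E\<^sub>2 S\<^sub>2"
    and nonempty: "S\<^sub>1 \<union> S\<^sub>2 \<noteq> {}"
    and ends: "S\<^sub>1 \<noteq> {} \<Longrightarrow> S\<^sub>2 \<noteq> {} \<Longrightarrow> a \<in> S\<^sub>1 \<and> b \<in> S\<^sub>2"
  shows "connected_on (E\<^sub>1 \<union> E\<^sub>2 \<union> {(a, b), (b, a)}) (S\<^sub>1 \<union> S\<^sub>2)" (is "connected_on ?E _")
proof -
  have conn: "S\<^sub>1 \<noteq> {} \<Longrightarrow> connected_on ?E S\<^sub>1" "S\<^sub>2 \<noteq> {} \<Longrightarrow> connected_on ?E S\<^sub>2"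
    by (rule connected_on_mono[OF S\<^sub>1] connected_on_mono[OF S\<^sub>2]; blast)+
  consider "S\<^sub>1 = {}" | "S\<^sub>2 = {}" | "S\<^sub>1 \<noteq> {}" "S\<^sub>2 \<noteq> {}" by blast
  then show ?thesis
  proof cases
    case 3
    then show ?thesis using ends by (intro connected_on_join[OF conn]) auto
  qed (use conn nonempty in simp_all)
qed

lemma connected_on_leaving_edge:
  assumes "connected_on E V" "S \<subseteq> V" "S \<noteq> {}" "S \<noteq> V"
  obtains a b where "(a, b) \<in> E" "a \<in> S" "b \<in> V - S"
proof -
  obtain u v where uv: "u \<in> S" "v \<in> V - S" using assms by blast
  then have "(u, v) \<in> (Restr E V)\<^sup>*" using assms by (auto simp: connected_on_def)
  then have "v \<in> S" if "\<nexists>a b. (a, b) \<in> E \<and> a \<in> S \<and> b \<in> V - S"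
    using uv(1) that by (induction rule: rtrancl_induct) auto
  then show thesis using uv(2) that by blast
qed

lemma neighbour_mem_connected_on:
  assumes "connected_on E S" "b \<in> S" "S \<noteq> {b}" and only_neighbour: "\<And>x. (b, x) \<in> E \<Longrightarrow> x = a"
  shows "a \<in> S"
proof -
  obtain u where u: "u \<in> S" "u \<noteq> b" using assms(2,3) by blast
  then have "(b, u) \<in> (Restr E S)\<^sup>*" using assms(1,2) by (auto simp: connected_on_def)
  then show ?thesis using u(2) only_neighbour by (cases rule: converse_rtranclE) auto
qed

lemma connected_on_remove_leaf:
  assumes conn: "connected_on (E \<union> {(a, b), (b, a)}) S" and "S \<noteq> {b}" and leaf: "b \<notin> Field E"
  shows "connected_on E (S - {b})"
proof -
  define contract where "contract z = (if z = b then a else z)" for z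
  have neighbour: "a \<in> S" if "b \<in> S"
    by (rule neighbour_mem_connected_on[OF conn that assms(2)]) (use leaf in \<open>auto simp: Field_def\<close>)
  have "(contract u, contract v) \<in> (Restr E (S - {b}))\<^sup>*"
    if "(u, v) \<in> (Restr (E \<union> {(a, b), (b, a)}) S)\<^sup>*" for u v
    using that
  proof (induction rule: rtrancl_induct)
    case (step y z)
    then have "contract y = contract z \<or> (contract y, contract z) \<in> Restr E (S - {b})"
      using leaf neighbour by (auto simp: contract_def Field_def)
    then show ?case using step.IH rtrancl_into_rtrancl by metis
  qed simp
  moreover have "contract u = u" if "u \<in> S - {b}" for u using that by (simp add: contract_def)
  ultimately have "(u, v) \<in> (Restr E (S - {b}))\<^sup>*" if "u \<in> S - {b}" "v \<in> S - {b}" for u v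
    using conn that unfolding connected_on_def by (metis DiffD1)
  moreover have "S - {b} \<noteq> {}" using conn \<open>S \<noteq> {b}\<close> by (auto simp: connected_on_def)
  ultimately show ?thesis by (simp add: connected_on_def)
qed

section \<open>Trees built by attaching leaves\<close>

inductive tree_on :: "'t set \<Rightarrow> 't rel \<Rightarrow> bool" where
  singleton: "tree_on {v} {}"
| attach_leaf: "tree_on V E \<Longrightarrow> a \<in> V \<Longrightarrow> b \<notin> V \<Longrightarrow>
    tree_on (insert b V) (E \<union> {(a, b), (b, a)})"

lemma tree_on_finite: "tree_on V E \<Longrightarrow> finite V"
  by (induction rule: tree_on.induct) auto

lemma tree_on_edges_subset: "tree_on V E \<Longrightarrow> E \<subseteq> V \<times> V"
  by (induction rule: tree_on.induct) auto

lemma tree_on_sym: "tree_on V E \<Longrightarrow> sym E"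
  by (induction rule: tree_on.induct) (auto simp: sym_def)

lemma tree_on_irrefl: "tree_on V E \<Longrightarrow> irrefl E"
  by (induction rule: tree_on.induct) (auto simp: irrefl_def)

lemma tree_on_connected: "tree_on V E \<Longrightarrow> connected_on E V"
proof (induction rule: tree_on.induct)
  case (attach_leaf V E a b)
  let ?E = "E \<union> {(a, b), (b, a)}"
  have "connected_on ?E V" using attach_leaf.IH by (rule connected_on_mono) blast
  then have "connected_on ?E (V \<union> {b})"
    using attach_leaf.hyps by (intro connected_on_join[OF _ connected_on_singleton]) auto
  then show ?case by simp
qed (rule connected_on_singleton)

lemma tree_on_nonempty: "tree_on V E \<Longrightarrow> V \<noteq> {}"
  by (induction rule: tree_on.induct) auto

lemma tree_on_image:
  assumes "tree_on V E" "inj_on f V"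
  shows "tree_on (f ` V) (map_prod f f ` E)"
  using assms
proof (induction rule: tree_on.induct)
  case (attach_leaf V E a b)
  then have "tree_on (insert (f b) (f ` V)) (map_prod f f ` E \<union> {(f a, f b), (f b, f a)})"
    by (intro tree_on.attach_leaf) auto
  then show ?case by (simp add: image_Un)
qed (simp add: tree_on.singleton)

lemma tree_on_join:
  assumes "tree_on V\<^sub>1 E\<^sub>1" "tree_on V\<^sub>2 E\<^sub>2" "V\<^sub>1 \<inter> V\<^sub>2 = {}" "a \<in> V\<^sub>1" "b \<in> V\<^sub>2"
  shows "tree_on (V\<^sub>1 \<union> V\<^sub>2) (E\<^sub>1 \<union> E\<^sub>2 \<union> {(a, b), (b, a)})"
  using assms(2,1,3-)
proof (induction arbitrary: V\<^sub>1 E\<^sub>1 a b rule: tree_on.induct)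
  case (singleton v)
  then show ?case using tree_on.attach_leaf[of V\<^sub>1 E\<^sub>1 a v] by simp
next
  case (attach_leaf V E c l)
  show ?case
  proof (cases "b = l")
    case True
    \<comment> \<open>Move \<open>l\<close> to the first tree and join it with the rest of the second one at \<open>c\<close>.\<close>
    have "tree_on (insert l V\<^sub>1) (E\<^sub>1 \<union> {(a, l), (l, a)})"
      using attach_leaf.prems by (intro tree_on.attach_leaf) auto
    then have "tree_on (insert l V\<^sub>1 \<union> V) (E\<^sub>1 \<union> {(a, l), (l, a)} \<union> E \<union> {(l, c), (c, l)})"
      using attach_leaf.hyps attach_leaf.prems by (intro attach_leaf.IH) auto
    then show ?thesis using True by (simp add: Un_ac insert_commute)
  next
    case False
    then have "tree_on (V\<^sub>1 \<union> V) (E\<^sub>1 \<union> E \<union> {(a, b), (b, a)})"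
      using attach_leaf.prems by (intro attach_leaf.IH) auto
    then have "tree_on (insert l (V\<^sub>1 \<union> V)) (E\<^sub>1 \<union> E \<union> {(a, b), (b, a)} \<union> {(c, l), (l, c)})"
      using attach_leaf.hyps attach_leaf.prems by (intro tree_on.attach_leaf) auto
    then show ?thesis by (simp add: Un_ac insert_commute)
  qed
qed

lemma tree_on_Helly:
  assumes "tree_on V E"
    and "\<And>S. S \<in> \<S> \<Longrightarrow> S \<subseteq> V" "\<And>S. S \<in> \<S> \<Longrightarrow> connected_on E S"
    and "\<And>S S'. S \<in> \<S> \<Longrightarrow> S' \<in> \<S> \<Longrightarrow> S \<inter> S' \<noteq> {}"
  shows "\<exists>t\<in>V. \<forall>S\<in>\<S>. t \<in> S"
  using assms
proof (induction arbitrary: \<S> rule: tree_on.induct)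
  case (singleton v)
  have "v \<in> S" if "S \<in> \<S>" for S
    using singleton.prems(1,2)[OF that] by (auto simp: connected_on_def)
  then show ?case by simp
next
  case (attach_leaf V E a b)
  have leaf: "b \<notin> Field E"
    using tree_on_edges_subset[OF attach_leaf.hyps(1)] attach_leaf.hyps(3) by (auto simp: Field_def)
  show ?case
  proof (cases "{b} \<in> \<S>")
    case True
    then have "b \<in> S" if "S \<in> \<S>" for S using attach_leaf.prems(3)[OF _ that] by auto
    then show ?thesis by simp
  next
    case False
    have neighbour: "a \<in> S" if "S \<in> \<S>" "b \<in> S" for S
      by (rule neighbour_mem_connected_on[OF attach_leaf.prems(2)[OF that(1)] that(2)])
        (use False that leaf in \<open>auto simp: Field_def\<close>)
    have "a \<noteq> b" using attach_leaf.hyps by blast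
    then have meet: "(S - {b}) \<inter> (S' - {b}) \<noteq> {}" if "S \<in> \<S>" "S' \<in> \<S>" for S S'
      using attach_leaf.prems(3)[OF that] neighbour[OF that(1)] neighbour[OF that(2)] by blast
    have "\<exists>t\<in>V. \<forall>S\<in>(\<lambda>S. S - {b}) ` \<S>. t \<in> S"
    proof (rule attach_leaf.IH)
      fix S assume "S \<in> (\<lambda>S. S - {b}) ` \<S>"
      then obtain S' where S': "S' \<in> \<S>" "S = S' - {b}" by blast
      then show "S \<subseteq> V" using attach_leaf.prems(1) by blast
      show "connected_on E S"
        unfolding S'(2) using attach_leaf.prems(2)[OF S'(1)] _ leaf
        by (rule connected_on_remove_leaf) (use S'(1) False in blast)
    qed (use meet in auto)
    then show ?thesis by auto
  qed
qed

lemma tree_on_ex_le_one_neighbour: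
  assumes "tree_on V E" "S \<noteq> {}"
  shows "\<exists>v\<in>S. \<forall>x\<in>S. \<forall>y\<in>S. (v, x) \<in> E \<longrightarrow> (v, y) \<in> E \<longrightarrow> x = y"
  using assms
proof (induction rule: tree_on.induct)
  case (attach_leaf V E a b)
  show ?case
  proof (cases "b \<in> S")
    case True
    have neighbour: "x = a" if "(b, x) \<in> E \<union> {(a, b), (b, a)}" for x
      using that tree_on_edges_subset[OF attach_leaf.hyps(1)] attach_leaf.hyps(3) by auto
    show ?thesis using neighbour by (intro bexI[OF _ True]) metis
  next
    case False
    obtain v where "v \<in> S" "\<forall>x\<in>S. \<forall>y\<in>S. (v, x) \<in> E \<longrightarrow> (v, y) \<in> E \<longrightarrow> x = y"
      using attach_leaf.IH[OF attach_leaf.prems] by blast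
    then show ?thesis using False by (intro bexI[of _ v]) auto
  qed
qed auto

lemma connected_on_ex_spanning_tree:
  assumes "finite V" "sym E" "connected_on E V"
  obtains F where "F \<subseteq> E" "tree_on V F"
proof -
  define subtrees where "subtrees = {S \<in> Pow V. \<exists>F\<subseteq>E. tree_on S F}"
  obtain r where "r \<in> V" using assms(3) by (auto simp: connected_on_def)
  then have "{r} \<in> subtrees" by (auto simp: subtrees_def intro!: exI[of _ "{}"] tree_on.singleton)
  moreover have "finite subtrees" using \<open>finite V\<close> by (simp add: subtrees_def)
  ultimately obtain S where "S \<in> subtrees" and max: "\<forall>S'\<in>subtrees. S \<subseteq> S' \<longrightarrow> S = S'"
    using finite_has_maximal[of subtrees] by blast
  then obtain F where S: "S \<subseteq> V" and F: "F \<subseteq> E" "tree_on S F" by (auto simp: subtrees_def)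
  have "S = V"
  proof (rule ccontr)
    assume "S \<noteq> V"
    then obtain a b where ab: "(a, b) \<in> E" "a \<in> S" "b \<in> V - S"
      using connected_on_leaving_edge[OF assms(3) S tree_on_nonempty[OF F(2)]] by blast
    then have "tree_on (insert b S) (F \<union> {(a, b), (b, a)})"
      using F(2) by (intro tree_on.attach_leaf) auto
    then have "insert b S \<in> subtrees"
      using S F(1) ab symD[OF \<open>sym E\<close> ab(1)] unfolding subtrees_def
      by (intro CollectI conjI exI[of _ "F \<union> {(a, b), (b, a)}"]) auto
    then show False using max ab(3) by blast
  qed
  then show thesis using F that by blast
qed

section \<open>Trees as symmetric digraphs\<close>

lemma arcs_ends_induce_subgraph: "arcs_ends (G \<restriction> S) = Restr (arcs_ends G) S"
  by (auto simp: arcs_ends_conv)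

lemma induce_subgraph_induce_subgraph: "S' \<subseteq> S \<Longrightarrow> (G \<restriction> S) \<restriction> S' = G \<restriction> S'"
  by (auto simp: induce_subgraph_def)

lemma connected_iff_connected_on:
  assumes "wf_digraph G" "symmetric G"
  shows "connected G \<longleftrightarrow> connected_on (arcs_ends G) (verts G)"
proof -
  interpret wf_digraph G by fact
  have Restr_verts: "Restr (arcs_ends G) (verts G) = arcs_ends G"
    using adj_in_verts by auto
  have "u \<rightarrow>\<^sup>*\<^bsub>mk_symmetric G\<^esub> v \<longleftrightarrow> (u, v) \<in> (arcs_ends G)\<^sup>*" if "u \<in> verts G" for u v
    using reachable_mk_symmetric_eq[OF assms(2)] reachable_conv'[OF that] by simp
  then show ?thesis
    unfolding connected_def strongly_connected_def connected_on_def Restr_verts by simp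
qed

lemma connected_induce_subgraph_iff:
  assumes "wf_digraph G" "symmetric G"
  shows "connected (G \<restriction> S) \<longleftrightarrow> connected_on (arcs_ends G) S"
proof -
  have "symmetric (G \<restriction> S)"
    using assms(2) by (auto simp: symmetric_def arcs_ends_induce_subgraph sym_def)
  moreover have "wf_digraph (G \<restriction> S)"
    using assms by (simp add: wf_digraph.wellformed_induce_subgraph)
  moreover have "Restr (Restr (arcs_ends G) S) S = Restr (arcs_ends G) S" by auto
  ultimately show ?thesis
    by (simp add: connected_iff_connected_on arcs_ends_induce_subgraph connected_on_def)
qed

lemma pawalk_verts_eq_Cons_map_snd: "pcas u p v \<Longrightarrow> pawalk_verts u p = u # map snd p"
  by (induction p arbitrary: u) auto

lemma map_fst_snoc_eq_Cons_map_snd: "pcas u p v \<Longrightarrow> map fst p @ [v] = u # map snd p"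
  by (induction p arbitrary: u) auto

lemma fst_nth_Suc_mod_if_closed_pcas:
  assumes "pcas u p u" "i < length p"
  shows "fst (p ! (Suc i mod length p)) = snd (p ! i)"
proof -
  have nth: "(map fst p @ [u]) ! k = (u # map snd p) ! k" for k
    using map_fst_snoc_eq_Cons_map_snd[OF assms(1)] by simp
  show ?thesis
  proof (cases "Suc i = length p")
    case True
    then have "fst (p ! 0) = u" "u = snd (p ! i)"
      using nth[of 0] nth[of "length p"] assms(2) True[symmetric] by (simp_all add: nth_append)
    then show ?thesis using True by simp
  next
    case False
    then show ?thesis using nth[of "Suc i"] assms(2) by (simp add: nth_append)
  qed
qed

lemma (in pair_sym_digraph) cycle_vertex_two_neighbours:
  assumes "cycle p" "length p \<ge> 3" "v \<in> snd ` set p"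
  shows "\<exists>x\<in>snd ` set p. \<exists>y\<in>snd ` set p. (v, x) \<in> parcs G \<and> (v, y) \<in> parcs G \<and> x \<noteq> y"
proof -
  define n where "n = length p"
  obtain u where "awalk u p u" "distinct (tl (pawalk_verts u p))"
    using assms(1) by (auto simp: cycle_def)
  then have closed: "pcas u p u" and arcs: "set p \<subseteq> parcs G" and dist: "distinct (map snd p)"
    using pawalk_verts_eq_Cons_map_snd[of u p u] by (simp_all add: awalk_def)
  obtain i where i: "i < n" "v = snd (p ! i)"
    using assms(3) by (auto simp: n_def in_set_conv_nth)
  define succ pred where "succ = Suc i mod n" and "pred = (i + n - 1) mod n"
  have indices: "succ < n" "pred < n" "succ \<noteq> pred" "Suc pred mod n = i"
    using i(1) assms(2) unfolding succ_def pred_def n_def[symmetric]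
    by (auto simp: mod_Suc mod_if)
  have "fst (p ! succ) = v" "fst (p ! i) = snd (p ! pred)"
    using fst_nth_Suc_mod_if_closed_pcas[OF closed] i indices by (auto simp: succ_def n_def)
  then have "p ! succ = (v, snd (p ! succ))" "p ! i = (snd (p ! pred), v)"
    using i(2) by (auto simp: prod_eq_iff)
  moreover have "p ! succ \<in> parcs G" "p ! i \<in> parcs G"
    using arcs indices(1) i(1) by (auto simp: n_def)
  ultimately have "(v, snd (p ! succ)) \<in> parcs G" "(v, snd (p ! pred)) \<in> parcs G"
    using arcs_symmetric by auto
  moreover have "snd (p ! succ) \<noteq> snd (p ! pred)"
    using nth_eq_iff_index_eq[OF dist, of succ pred] indices(1-3) by (simp add: n_def)
  moreover have "snd (p ! succ) \<in> snd ` set p" "snd (p ! pred) \<in> snd ` set p"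
    using indices(1,2) by (simp_all add: n_def)
  ultimately show ?thesis by blast
qed

lemma (in pair_loopfree_digraph) ex_cycle_ge_3_if_chord:
  assumes "F \<subseteq> parcs G" "(x, y) \<in> F\<^sup>*" "(x, y) \<notin> F" "(y, x) \<in> parcs G"
  shows "\<exists>p. cycle p \<and> length p \<ge> 3"
proof -
  define H where "H = \<lparr>pverts = pverts G, parcs = F\<rparr>"
  interpret H: pair_wf_digraph H
    using assms(1) by unfold_locales (auto simp: H_def in_arcsD1 in_arcsD2)
  have "x \<rightarrow>\<^sup>*\<^bsub>with_proj H\<^esub> y"
    using assms(2,4) H.reachable_conv'[of x y] by (simp add: H_def in_arcsD2)
  then obtain p where "H.apath x p y" using H.reachable_apath by blast
  then have "pcas x p y" "set p \<subseteq> parcs H" "distinct (pawalk_verts x p)"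
    by (simp_all add: H.apath_def H.awalk_def)
  then have path: "pcas x p y" "set p \<subseteq> F" "distinct (pawalk_verts x p)"
    by (simp_all add: H_def)
  have "x \<noteq> y" using no_loops' assms(4) by blast
  then have "length p \<ge> 2" using path(1,2) assms(3) by (cases p; cases "tl p") auto
  moreover have "cycle ((y, x) # p)"
    using path assms(1,4) in_arcsD1 unfolding cycle_def awalk_def by auto
  ultimately show ?thesis by (intro exI[of _ "(y, x) # p"]) simp
qed

lemma tree_on_if_undirected_tree:
  assumes "undirected_tree (with_proj T)"
  shows "tree_on (pverts T) (parcs T)"
proof -
  interpret T: pair_graph T
    using assms by (auto simp: undirected_tree_def intro: pair_graphI_graph)
  have "sym (parcs T)" using T.sym_arcs by (simp add: symmetric_def)
  moreover have "connected_on (parcs T) (pverts T)"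
    using assms connected_iff_connected_on[of "with_proj T"] T.wf_digraph T.sym_arcs
    by (simp add: undirected_tree_def)
  ultimately obtain F where F: "F \<subseteq> parcs T" "tree_on (pverts T) F"
    using connected_on_ex_spanning_tree[OF T.pair_finite_verts] by metis
  have "(x, y) \<in> F" if "(x, y) \<in> parcs T" for x y
  proof (rule ccontr)
    assume "(x, y) \<notin> F"
    moreover have "(x, y) \<in> (Restr F (pverts T))\<^sup>*"
      using tree_on_connected[OF F(2)] that T.wellformed' by (auto simp: connected_on_def)
    then have "(x, y) \<in> F\<^sup>*" by (rule rtrancl_mono[THEN subsetD, rotated]) blast
    ultimately show False
      using assms T.ex_cycle_ge_3_if_chord[OF F(1)] T.arcs_symmetric[OF that]
      by (auto simp: undirected_tree_def)
  qed
  then have "F = parcs T" using F(1) by auto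
  then show ?thesis using F(2) by simp
qed

lemma undirected_tree_if_tree_on:
  assumes "tree_on (pverts T) (parcs T)"
  shows "undirected_tree (with_proj T)"
proof -
  note finite = tree_on_finite[OF assms] and arcs = tree_on_edges_subset[OF assms]
  interpret T: pair_graph T
  proof
    show "finite (parcs T)" using arcs finite by (meson finite_SigmaI finite_subset)
  qed (use arcs finite tree_on_sym[OF assms] tree_on_irrefl[OF assms]
      in \<open>auto simp: symmetric_def irrefl_def\<close>)
  have "connected (with_proj T)"
    using connected_iff_connected_on[of "with_proj T"] T.wf_digraph T.sym_arcs
      tree_on_connected[OF assms] by simp
  moreover have False if "T.cycle p" "length p \<ge> 3" for p
  proof -
    have "snd ` set p \<noteq> {}" using that(2) by auto
    then show False
      using tree_on_ex_le_one_neighbour[OF assms] T.cycle_vertex_two_neighbours[OF that] by meson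
  qed
  ultimately show ?thesis using T.pair_graphD_graph by (auto simp: undirected_tree_def)
qed

lemma undirected_tree_with_proj_iff:
  "undirected_tree (with_proj T) \<longleftrightarrow> tree_on (pverts T) (parcs T)"
  using tree_on_if_undirected_tree undirected_tree_if_tree_on by blast

section \<open>Tree decompositions\<close>

text \<open>Every vertex lies in some bag, since \<open>connected_on\<close> includes nonemptiness.\<close>

definition tree_decomposition_on ::
  "('a, 'b) pre_digraph \<Rightarrow> 't set \<Rightarrow> 't rel \<Rightarrow> ('t \<Rightarrow> 'a set) \<Rightarrow> bool" where
  "tree_decomposition_on G V E X \<longleftrightarrow>
     tree_on V E \<and>
     (\<forall>t\<in>V. X t \<subseteq> verts G) \<and>
     (\<forall>u v. u \<rightarrow>\<^bsub>G\<^esub> v \<longrightarrow> (\<exists>t\<in>V. u \<in> X t \<and> v \<in> X t)) \<and>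
     (\<forall>u\<in>verts G. connected_on E {t \<in> V. u \<in> X t})"

lemma tree_decomposition_with_proj_iff:
  "tree_decomposition G (with_proj T) X \<longleftrightarrow> tree_decomposition_on G (pverts T) (parcs T) X"
proof (cases "undirected_tree (with_proj T)")
  case True
  then interpret T: pair_graph T
    by (auto simp: undirected_tree_def intro: pair_graphI_graph)
  have "connected (with_proj T \<restriction> {t \<in> pverts T. P t}) \<longleftrightarrow>
      connected_on (parcs T) {t \<in> pverts T. P t}" for P
    using connected_induce_subgraph_iff[of "with_proj T" "{t \<in> pverts T. P t}"]
      T.wf_digraph T.sym_arcs by auto
  then show ?thesis
    unfolding tree_decomposition_def tree_decomposition_on_def undirected_tree_with_proj_iff
    by (auto simp: connected_on_def)
next
  case False
  then show ?thesis
    by (simp add: tree_decomposition_def tree_decomposition_on_def undirected_tree_with_proj_iff)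
qed

lemma tree_decomposition_on_singleton:
  assumes "wf_digraph G"
  shows "tree_decomposition_on G {t} {} (\<lambda>_. verts G)"
  using wf_digraph.adj_in_verts[OF assms]
  by (auto simp: tree_decomposition_on_def tree_on.singleton connected_on_def)

lemma tree_decomposition_on_image:
  assumes "tree_decomposition_on G V E X" "inj_on f V" and Y: "\<And>t. t \<in> V \<Longrightarrow> Y (f t) = X t"
  shows "tree_decomposition_on G (f ` V) (map_prod f f ` E) Y"
proof -
  have "{t \<in> f ` V. u \<in> Y t} = f ` {t \<in> V. u \<in> X t}" for u
    using Y by auto
  then show ?thesis
    using assms by (simp add: tree_decomposition_on_def tree_on_image connected_on_image)
qed

lemma tree_decomposition_on_induce_subgraph:
  assumes "tree_decomposition_on G V E X" "S \<subseteq> verts G"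
  shows "tree_decomposition_on (G \<restriction> S) V E (\<lambda>t. X t \<inter> S)"
  unfolding tree_decomposition_on_def
proof (intro conjI ballI allI impI)
  fix u assume "u \<in> verts (G \<restriction> S)"
  then have "u \<in> S" by simp
  then have "{t \<in> V. u \<in> X t \<inter> S} = {t \<in> V. u \<in> X t}" by auto
  with assms \<open>u \<in> S\<close> show "connected_on E {t \<in> V. u \<in> X t \<inter> S}"
    by (auto simp: tree_decomposition_on_def)
next
  fix u v assume "u \<rightarrow>\<^bsub>G \<restriction> S\<^esub> v"
  then show "\<exists>t\<in>V. u \<in> X t \<inter> S \<and> v \<in> X t \<inter> S"
    using assms by (auto simp: tree_decomposition_on_def arcs_ends_induce_subgraph)
qed (use assms in \<open>auto simp: tree_decomposition_on_def\<close>)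

lemma clique_subset_bag:
  assumes "tree_decomposition_on G V E X" "clique G C"
  shows "\<exists>t\<in>V. C \<subseteq> X t"
proof -
  let ?nodes = "\<lambda>u. {t \<in> V. u \<in> X t}"
  have conn: "connected_on E (?nodes u)" if "u \<in> C" for u
    using assms that by (auto simp: tree_decomposition_on_def clique_def)
  have meet: "?nodes u \<inter> ?nodes v \<noteq> {}" if "u \<in> C" "v \<in> C" for u v
  proof (cases "u = v")
    case True
    then show ?thesis using conn[OF that(1)] by (simp add: connected_on_def)
  next
    case False
    then have "u \<rightarrow>\<^bsub>G\<^esub> v" using assms(2) that by (auto simp: clique_def pairwise_def)
    then obtain t where "t \<in> V" "u \<in> X t" "v \<in> X t"
      using assms(1) unfolding tree_decomposition_on_def by blast
    then show ?thesis by blast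
  qed
  have "\<exists>t\<in>V. \<forall>S\<in>?nodes ` C. t \<in> S"
  proof (rule tree_on_Helly)
    show "tree_on V E" using assms(1) by (simp add: tree_decomposition_on_def)
    show "S \<subseteq> V" "connected_on E S" if "S \<in> ?nodes ` C" for S using that conn by auto
    show "S \<inter> S' \<noteq> {}" if "S \<in> ?nodes ` C" "S' \<in> ?nodes ` C" for S S'
      using that by (elim imageE) (simp only: meet not_False_eq_True)
  qed
  then show ?thesis by auto
qed

section \<open>Separations\<close>

definition separation :: "('a, 'b) pre_digraph \<Rightarrow> 'a set \<Rightarrow> 'a set \<Rightarrow> bool" where
  "separation G S\<^sub>1 S\<^sub>2 \<longleftrightarrow> verts G = S\<^sub>1 \<union> S\<^sub>2 \<and>
     (\<forall>u v. u \<rightarrow>\<^bsub>G\<^esub> v \<longrightarrow> u \<in> S\<^sub>1 \<and> v \<in> S\<^sub>1 \<or> u \<in> S\<^sub>2 \<and> v \<in> S\<^sub>2)"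

lemma separation_if_cut_partition:
  assumes "wf_digraph G" "cut_partition G A B C"
  shows "separation G (A \<union> C) (B \<union> C)"
proof -
  have verts: "verts G = A \<union> B \<union> C"
    and no_edge: "\<And>u v. u \<in> A \<Longrightarrow> v \<in> B \<Longrightarrow> \<not> u \<rightarrow>\<^bsub>G\<^esub> v \<and> \<not> v \<rightarrow>\<^bsub>G\<^esub> u"
    using assms(2) by (simp_all add: cut_partition_def)
  have "u \<in> A \<union> C \<and> v \<in> A \<union> C \<or> u \<in> B \<union> C \<and> v \<in> B \<union> C" if "u \<rightarrow>\<^bsub>G\<^esub> v" for u v
    using wf_digraph.adj_in_verts[OF assms(1) that] no_edge[of u v] no_edge[of v u] that
    unfolding verts by blast
  then show ?thesis unfolding separation_def using verts by blast
qed

lemma tree_decomposition_on_join: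
  assumes dec\<^sub>1: "tree_decomposition_on (G \<restriction> S\<^sub>1) V\<^sub>1 E\<^sub>1 X"
    and dec\<^sub>2: "tree_decomposition_on (G \<restriction> S\<^sub>2) V\<^sub>2 E\<^sub>2 X"
    and sep: "separation G S\<^sub>1 S\<^sub>2" and disj: "V\<^sub>1 \<inter> V\<^sub>2 = {}"
    and a: "a \<in> V\<^sub>1" "S\<^sub>1 \<inter> S\<^sub>2 \<subseteq> X a" and b: "b \<in> V\<^sub>2" "S\<^sub>1 \<inter> S\<^sub>2 \<subseteq> X b"
  shows "tree_decomposition_on G (V\<^sub>1 \<union> V\<^sub>2) (E\<^sub>1 \<union> E\<^sub>2 \<union> {(a, b), (b, a)}) X"
    (is "tree_decomposition_on G ?V ?E X")
proof -
  have trees: "tree_on V\<^sub>1 E\<^sub>1" "tree_on V\<^sub>2 E\<^sub>2"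
    and bags: "\<And>t. t \<in> V\<^sub>1 \<Longrightarrow> X t \<subseteq> S\<^sub>1" "\<And>t. t \<in> V\<^sub>2 \<Longrightarrow> X t \<subseteq> S\<^sub>2"
    and conn: "\<And>u. u \<in> S\<^sub>1 \<Longrightarrow> connected_on E\<^sub>1 {t \<in> V\<^sub>1. u \<in> X t}"
      "\<And>u. u \<in> S\<^sub>2 \<Longrightarrow> connected_on E\<^sub>2 {t \<in> V\<^sub>2. u \<in> X t}"
    using dec\<^sub>1 dec\<^sub>2 by (simp_all add: tree_decomposition_on_def)
  have "connected_on ?E {t \<in> ?V. u \<in> X t}" if "u \<in> verts G" for u
  proof -
    let ?nodes = "\<lambda>V. {t \<in> V. u \<in> X t}"
    have mem: "?nodes V\<^sub>1 \<noteq> {} \<Longrightarrow> u \<in> S\<^sub>1" "?nodes V\<^sub>2 \<noteq> {} \<Longrightarrow> u \<in> S\<^sub>2"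
      using bags by blast+
    have "connected_on ?E (?nodes V\<^sub>1 \<union> ?nodes V\<^sub>2)"
    proof (rule connected_on_Un_edge[OF conn(1)[OF mem(1)] conn(2)[OF mem(2)]])
      have "u \<in> S\<^sub>1 \<or> u \<in> S\<^sub>2" using that sep by (simp add: separation_def)
      then show "?nodes V\<^sub>1 \<union> ?nodes V\<^sub>2 \<noteq> {}"
        using conn[of u] unfolding connected_on_def by blast
      show "a \<in> ?nodes V\<^sub>1 \<and> b \<in> ?nodes V\<^sub>2" if "?nodes V\<^sub>1 \<noteq> {}" "?nodes V\<^sub>2 \<noteq> {}"
        using mem(1)[OF that(1)] mem(2)[OF that(2)] a b by blast
    qed
    moreover have "?nodes ?V = ?nodes V\<^sub>1 \<union> ?nodes V\<^sub>2" by blast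
    ultimately show ?thesis by (simp only:)
  qed
  moreover have "\<exists>t\<in>?V. u \<in> X t \<and> v \<in> X t" if uv: "u \<rightarrow>\<^bsub>G\<^esub> v" for u v
  proof -
    have "u \<rightarrow>\<^bsub>G \<restriction> S\<^sub>1\<^esub> v \<or> u \<rightarrow>\<^bsub>G \<restriction> S\<^sub>2\<^esub> v"
      using sep uv by (auto simp: separation_def arcs_ends_induce_subgraph)
    then show ?thesis using dec\<^sub>1 dec\<^sub>2 unfolding tree_decomposition_on_def by blast
  qed
  moreover have "X t \<subseteq> verts G" if "t \<in> ?V" for t
    using that bags[of t] sep by (auto simp: separation_def)
  ultimately show ?thesis
    using tree_on_join[OF trees disj a(1) b(1)] by (simp add: tree_decomposition_on_def)
qed

section \<open>The tree-independence number\<close>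

lemma indep_number_induce_mono:
  assumes "finite S'" "S \<subseteq> S'"
  shows "indep_number (G \<restriction> S) \<le> indep_number (G \<restriction> S')"
proof -
  let ?sizes = "\<lambda>S. {card I | I. indep_set (G \<restriction> S) I}"
  have "?sizes S' \<subseteq> card ` Pow S'" by (auto simp: indep_set_def)
  then have "finite (?sizes S')" using assms(1) by (meson finite_Pow_iff finite_imageI finite_subset)
  moreover have "?sizes S \<subseteq> ?sizes S'"
    using assms(2) by (auto simp: indep_set_def arcs_ends_induce_subgraph) blast
  moreover have "0 \<in> ?sizes S" by (auto simp: indep_set_def intro!: exI[of _ "{}"])
  ultimately show ?thesis unfolding indep_number_def by (intro Max_mono) auto
qed

lemma decomp_indep_number_le_iff:
  assumes "finite (verts T)" "verts T \<noteq> {}"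
  shows "decomp_indep_number G T X \<le> k \<longleftrightarrow> (\<forall>t\<in>verts T. indep_number (G \<restriction> X t) \<le> k)"
proof -
  have "{indep_number (G \<restriction> X t) | t. t \<in> verts T} = (\<lambda>t. indep_number (G \<restriction> X t)) ` verts T"
    by auto
  then show ?thesis using assms unfolding decomp_indep_number_def by simp
qed

lemma tree_alpha_le:
  fixes V :: "'t set"
  assumes dec: "tree_decomposition_on G V E X"
    and le: "\<And>t. t \<in> V \<Longrightarrow> indep_number (G \<restriction> X t) \<le> k"
  shows "tree_alpha G \<le> k"
proof -
  have finite: "finite V" and nonempty: "V \<noteq> {}"
    using dec tree_on_finite tree_on_nonempty by (auto simp: tree_decomposition_on_def)
  obtain f :: "'t \<Rightarrow> nat" where inj: "inj_on f V"
    using finite_imp_inj_to_nat_seg[OF finite] by blast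
  define T where "T = \<lparr>pverts = f ` V, parcs = map_prod f f ` E\<rparr>"
  let ?Y = "\<lambda>n. X (inv_into V f n)"
  have "tree_decomposition_on G (pverts T) (parcs T) ?Y"
    unfolding T_def pair_pre_digraph.simps
    by (rule tree_decomposition_on_image[OF dec inj]) (simp add: inj)
  then have "tree_alpha G \<le> decomp_indep_number G (with_proj T) ?Y"
    unfolding tree_alpha_def by (intro Least_le) (auto simp: tree_decomposition_with_proj_iff)
  also have "\<dots> \<le> k"
    using finite nonempty le inj by (subst decomp_indep_number_le_iff) (auto simp: T_def)
  finally show ?thesis .
qed

lemma tree_alpha_decomposition:
  assumes "wf_digraph G"
  obtains V :: "nat set" and E X
  where "tree_decomposition_on G V E X"
    "\<And>t. t \<in> V \<Longrightarrow> indep_number (G \<restriction> X t) \<le> tree_alpha G"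
proof -
  have "tree_decomposition G (with_proj \<lparr>pverts = {0 :: nat}, parcs = {}\<rparr>) (\<lambda>_. verts G)"
    using tree_decomposition_on_singleton[OF assms]
    by (simp add: tree_decomposition_with_proj_iff)
  then have "\<exists>k (T :: nat pair_pre_digraph) X. tree_decomposition G (with_proj T) X \<and>
      decomp_indep_number G (with_proj T) X = k" by blast
  from LeastI_ex[OF this] obtain T :: "nat pair_pre_digraph" and X
    where dec: "tree_decomposition_on G (pverts T) (parcs T) X"
      and eq: "decomp_indep_number G (with_proj T) X = tree_alpha G"
    by (auto simp: tree_alpha_def tree_decomposition_with_proj_iff)
  have "finite (pverts T)" "pverts T \<noteq> {}"
    using dec tree_on_finite tree_on_nonempty by (auto simp: tree_decomposition_on_def)
  then have "\<forall>t\<in>pverts T. indep_number (G \<restriction> X t) \<le> tree_alpha G"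
    using decomp_indep_number_le_iff[of "with_proj T" G X "tree_alpha G"] eq by simp
  then show thesis using dec that by blast
qed

lemma tree_alpha_induce_subgraph_le:
  assumes "fin_digraph G" "S \<subseteq> verts G"
  shows "tree_alpha (G \<restriction> S) \<le> tree_alpha G"
proof -
  interpret fin_digraph G by fact
  obtain V :: "nat set" and E X where dec: "tree_decomposition_on G V E X"
    and le: "\<And>t. t \<in> V \<Longrightarrow> indep_number (G \<restriction> X t) \<le> tree_alpha G"
    using tree_alpha_decomposition[OF wf_digraph] by blast
  show ?thesis
  proof (rule tree_alpha_le[OF tree_decomposition_on_induce_subgraph[OF dec assms(2)]])
    fix t assume "t \<in> V"
    then have "finite (X t)"
      using dec finite_subset[OF _ finite_verts] by (auto simp: tree_decomposition_on_def)
    then have "indep_number (G \<restriction> (X t \<inter> S)) \<le> indep_number (G \<restriction> X t)"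
      by (intro indep_number_induce_mono) auto
    then show "indep_number ((G \<restriction> S) \<restriction> (X t \<inter> S)) \<le> tree_alpha G"
      using le[OF \<open>t \<in> V\<close>] by (simp add: induce_subgraph_induce_subgraph)
  qed
qed

lemma tree_alpha_decomposition_clique_bag:
  assumes "wf_digraph G" "clique G C" "C \<subseteq> S"
  obtains V :: "nat set" and E X a
  where "tree_decomposition_on (G \<restriction> S) V E X" "a \<in> V" "C \<subseteq> X a"
    "\<And>t. t \<in> V \<Longrightarrow> indep_number (G \<restriction> X t) \<le> tree_alpha (G \<restriction> S)"
proof -
  have "wf_digraph (G \<restriction> S)" using wf_digraph.wellformed_induce_subgraph[OF assms(1)] .
  then obtain V :: "nat set" and E X where dec: "tree_decomposition_on (G \<restriction> S) V E X"
    and le: "\<And>t. t \<in> V \<Longrightarrow> indep_number ((G \<restriction> S) \<restriction> X t) \<le> tree_alpha (G \<restriction> S)"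
    using tree_alpha_decomposition by blast
  have "clique (G \<restriction> S) C"
    using assms(2,3) by (auto simp: clique_def pairwise_def arcs_ends_induce_subgraph)
  then obtain a where "a \<in> V" "C \<subseteq> X a" using clique_subset_bag[OF dec] by blast
  moreover have "indep_number (G \<restriction> X t) \<le> tree_alpha (G \<restriction> S)" if "t \<in> V" for t
    using le[OF that] dec that
    by (simp add: tree_decomposition_on_def induce_subgraph_induce_subgraph)
  ultimately show thesis using dec that by blast
qed

lemma tree_alpha_le_max_if_clique_separation:
  assumes "wf_digraph G" and sep: "separation G S\<^sub>1 S\<^sub>2" and "clique G (S\<^sub>1 \<inter> S\<^sub>2)"
  shows "tree_alpha G \<le> max (tree_alpha (G \<restriction> S\<^sub>1)) (tree_alpha (G \<restriction> S\<^sub>2))"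
proof -
  obtain V\<^sub>1 :: "nat set" and E\<^sub>1 X\<^sub>1 a where
    dec\<^sub>1: "tree_decomposition_on (G \<restriction> S\<^sub>1) V\<^sub>1 E\<^sub>1 X\<^sub>1" and a: "a \<in> V\<^sub>1" "S\<^sub>1 \<inter> S\<^sub>2 \<subseteq> X\<^sub>1 a" and
    le\<^sub>1: "\<And>t. t \<in> V\<^sub>1 \<Longrightarrow> indep_number (G \<restriction> X\<^sub>1 t) \<le> tree_alpha (G \<restriction> S\<^sub>1)"
    using tree_alpha_decomposition_clique_bag[OF assms(1,3) Int_lower1] by blast
  obtain V\<^sub>2 :: "nat set" and E\<^sub>2 X\<^sub>2 b where
    dec\<^sub>2: "tree_decomposition_on (G \<restriction> S\<^sub>2) V\<^sub>2 E\<^sub>2 X\<^sub>2" and b: "b \<in> V\<^sub>2" "S\<^sub>1 \<inter> S\<^sub>2 \<subseteq> X\<^sub>2 b" and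
    le\<^sub>2: "\<And>t. t \<in> V\<^sub>2 \<Longrightarrow> indep_number (G \<restriction> X\<^sub>2 t) \<le> tree_alpha (G \<restriction> S\<^sub>2)"
    using tree_alpha_decomposition_clique_bag[OF assms(1,3) Int_lower2] by blast
  let ?X = "case_sum X\<^sub>1 X\<^sub>2"
  have "tree_decomposition_on (G \<restriction> S\<^sub>1) (Inl ` V\<^sub>1) (map_prod Inl Inl ` E\<^sub>1) ?X"
    by (rule tree_decomposition_on_image[OF dec\<^sub>1]) simp_all
  moreover have "tree_decomposition_on (G \<restriction> S\<^sub>2) (Inr ` V\<^sub>2) (map_prod Inr Inr ` E\<^sub>2) ?X"
    by (rule tree_decomposition_on_image[OF dec\<^sub>2]) simp_all
  moreover have "Inl ` V\<^sub>1 \<inter> Inr ` V\<^sub>2 = {}" by auto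
  moreover have "S\<^sub>1 \<inter> S\<^sub>2 \<subseteq> ?X (Inl a)" "S\<^sub>1 \<inter> S\<^sub>2 \<subseteq> ?X (Inr b)" using a(2) b(2) by simp_all
  ultimately have "tree_decomposition_on G (Inl ` V\<^sub>1 \<union> Inr ` V\<^sub>2)
      (map_prod Inl Inl ` E\<^sub>1 \<union> map_prod Inr Inr ` E\<^sub>2 \<union> {(Inl a, Inr b), (Inr b, Inl a)}) ?X"
    using sep a(1) b(1) by (intro tree_decomposition_on_join) simp_all
  then show ?thesis
    by (rule tree_alpha_le) (auto simp: le_max_iff_disj le\<^sub>1 le\<^sub>2)
qed

theorem tree_alpha_clique_separation:
  assumes "fin_digraph G" and sep: "separation G S\<^sub>1 S\<^sub>2" and "clique G (S\<^sub>1 \<inter> S\<^sub>2)"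
  shows "tree_alpha G = max (tree_alpha (G \<restriction> S\<^sub>1)) (tree_alpha (G \<restriction> S\<^sub>2))"
proof (rule antisym)
  interpret fin_digraph G by fact
  show "tree_alpha G \<le> max (tree_alpha (G \<restriction> S\<^sub>1)) (tree_alpha (G \<restriction> S\<^sub>2))"
    using wf_digraph sep assms(3) by (rule tree_alpha_le_max_if_clique_separation)
  have "S\<^sub>1 \<subseteq> verts G" "S\<^sub>2 \<subseteq> verts G" using sep by (auto simp: separation_def)
  then show "max (tree_alpha (G \<restriction> S\<^sub>1)) (tree_alpha (G \<restriction> S\<^sub>2)) \<le> tree_alpha G"
    using tree_alpha_induce_subgraph_le[OF assms(1)] by simp
qed

theorem corollary3p11:
  fixes G :: "('a, 'b) pre_digraph" and A B C :: "'a set"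
  assumes "graph G"
    and "clique_cutset G C"
    and "cut_partition G A B C"
  shows "tree_alpha G = max (tree_alpha (G \<restriction> (A \<union> C))) (tree_alpha (G \<restriction> (B \<union> C)))"
proof (rule tree_alpha_clique_separation)
  interpret graph G by fact
  show "fin_digraph G" by (rule fin_digraph)
  show "separation G (A \<union> C) (B \<union> C)"
    using wf_digraph assms(3) by (rule separation_if_cut_partition)
  have "(A \<union> C) \<inter> (B \<union> C) = C" using assms(3) by (auto simp: cut_partition_def)
  then show "clique G ((A \<union> C) \<inter> (B \<union> C))" using assms(2) by (simp add: clique_cutset_def)
qed

end
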